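(* There are connected nonisomorphic finite simple graphs $G,H$ on $78$ vertices, with the same degree sequence, such that $$b(G,H)\ge 51>50=Q(78).$$
   Context: For a finite simple graph $G$ and $v\in V(G)$, the graph $G-v$ (considered up to isomorphism) is a card of $G$, and the vertex deck of $G$ is the multiset $\mathcal D(G)=\{G-v : v\in V(G)\}$, with multiplicity. For graphs $G,H$ of the same order, $b(G,H)=|\mathcal D(G)\cap\mathcal D(H)|$ is the size of the multiset intersection; equivalently, $b(G,H)$ is the maximum $m$ for which there are $m$ distinct vertices $v_1,\dots,v_m$ of $G$ and $m$ distinct vertices $w_1,\dots,w_m$ of $H$ with $G-v_i\cong H-w_i$ for all $i$. Also $Q(n)=2\lfloor (n-1)/3\rfloor$. Two graphs have the same degree sequence if their multisets of vertex degrees agree. *)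

theory Defs
  imports Complex_Main "HOL-Library.Multiset" "Graph_Theory.Graph_Theory"
begin

text \<open>
  Finite simple graphs are the library's \<^locale>\<open>graph\<close>s: finite symmetric digraphs without loops
  and without parallel arcs, where each edge is represented by its two orientations.
\<close>

text \<open>
  Isomorphism classes are formed among the graphs over the same types of vertices and arcs. As the
  lemma below shows, equality of classes is then exactly isomorphism.
\<close>

definition iso_class :: "('a, 'b) pre_digraph \<Rightarrow> ('a, 'b) pre_digraph set" where
  "iso_class G = {K. digraph_iso G K}"

lemma digraph_iso_refl:
  assumes "wf_digraph G"
  shows "digraph_iso G G"
proof -
  let ?f = "\<lparr>iso_verts = id, iso_arcs = id, iso_head = head G, iso_tail = tail G\<rparr>"
  have "pre_digraph.digraph_isomorphism G ?f" and "G = app_iso ?f G"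
    using assms by (simp_all add: pre_digraph.digraph_isomorphism_def app_iso_def)
  then show ?thesis
    unfolding digraph_iso_def by blast
qed

lemma iso_class_eq_iff:
  assumes "wf_digraph G" "wf_digraph H"
  shows "iso_class G = iso_class H \<longleftrightarrow> digraph_iso G H"
proof
  assume "iso_class G = iso_class H"
  then show "digraph_iso G H"
    using digraph_iso_refl[OF assms(2)] unfolding iso_class_def by blast
next
  assume "digraph_iso G H"
  then show "iso_class G = iso_class H"
    unfolding iso_class_def
    using digraph_iso_swap[OF assms(1)] digraph_iso_trans by blast
qed

definition vertex_card :: "('a, 'b) pre_digraph \<Rightarrow> 'a \<Rightarrow> ('a, 'b) pre_digraph set" where
  "vertex_card G v = iso_class (pre_digraph.del_vert G v)"

definition vertex_deck :: "('a, 'b) pre_digraph \<Rightarrow> ('a, 'b) pre_digraph set multiset" where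
  "vertex_deck G = image_mset (vertex_card G) (mset_set (verts G))"

definition common_cards :: "('a, 'b) pre_digraph \<Rightarrow> ('a, 'b) pre_digraph \<Rightarrow> nat" where
  "common_cards G H = size (vertex_deck G \<inter># vertex_deck H)"

text \<open>In a \<^locale>\<open>graph\<close> the out-degree of a vertex is its number of neighbours.\<close>

definition degree_sequence :: "('a, 'b) pre_digraph \<Rightarrow> nat multiset" where
  "degree_sequence G = image_mset (out_degree G) (mset_set (verts G))"

definition Q :: "nat \<Rightarrow> int" where
  "Q n = 2 * \<lfloor>(real n - 1) / 3\<rfloor>"

end

theory Submission
  imports Defs
begin

text \<open>
  Take a graph on twelve vertices with four blocks of three vertices such that exactly the even
  permutations of the blocks extend to automorphisms, and attach to the blocks independent sets of
  15, 16, 17 and 18 leaves, each leaf being adjacent to the three vertices of its block. Since the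
  four sizes differ, the even and the odd assignments of sizes to blocks give two nonisomorphic
  graphs. Deleting a leaf from any but the smallest set makes two sizes equal, so that an odd
  permutation of the blocks can be corrected by a transposition of two equal sizes: the
  \<open>16 + 17 + 18 = 51\<close> corresponding cards agree.
\<close>

declare One_nat_def [simp del]

text \<open>Gluing one bijection per fibre gives a matching that respects the labels. It later
  supplies the part of an isomorphism that moves the leaves.\<close>

lemma bij_betw_fibres:
  assumes "finite V" "finite W"
    and fib: "\<And>b. card {v \<in> V. f v = b} = card {w \<in> W. g w = b}"
  obtains h where "bij_betw h V W" "\<And>v. v \<in> V \<Longrightarrow> g (h v) = f v"
proof -
  have "\<exists>k. bij_betw k {v \<in> V. f v = b} {w \<in> W. g w = b}" for b
    using assms by (intro finite_same_card_bij) auto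
  then obtain k where k: "\<And>b. bij_betw (k b) {v \<in> V. f v = b} {w \<in> W. g w = b}"
    by metis
  define h where "h v = k (f v) v" for v
  have hW: "h v \<in> W" and gh: "g (h v) = f v" if "v \<in> V" for v
    using bij_betwE[OF k[of "f v"]] that unfolding h_def by auto
  have "inj_on h V"
  proof (rule inj_onI)
    fix u v assume uv: "u \<in> V" "v \<in> V" "h u = h v"
    then have "f u = f v" using gh by metis
    with uv show "u = v"
      using bij_betw_imp_inj_on[OF k[of "f v"]] unfolding h_def by (auto dest: inj_onD)
  qed
  moreover have "w \<in> h ` V" if "w \<in> W" for w
  proof -
    have "w \<in> k (g w) ` {v \<in> V. f v = g w}"
      using bij_betw_imp_surj_on[OF k[of "g w"]] that by auto
    then show ?thesis unfolding h_def by force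
  qed
  ultimately have "bij_betw h V W"
    using hW by (auto simp: bij_betw_def)
  then show ?thesis using gh that by blast
qed

text \<open>
  The triples \<open>(i, j, k)\<close> which, followed by the remaining element of \<open>{0, 1, 2, 3}\<close>, are an even
  permutation. The ordered pair \<open>(i, j)\<close> is encoded as the vertex \<open>4 * i + j\<close> of the hub and belongs
  to block \<open>i\<close>; with the arcs below the hub is a truncated tetrahedron, whose odd symmetries do not
  respect the blocks.
\<close>

definition turns :: "(nat \<times> nat \<times> nat) set" where
  "turns = {(0,1,2), (1,2,0), (2,0,1), (0,2,3), (2,3,0), (3,0,2),
            (0,3,1), (3,1,0), (1,0,3), (1,3,2), (3,2,1), (2,1,3)}"

definition hub :: "nat set" where
  "hub = (\<lambda>(i, j, k). 4 * i + j) ` turns"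

definition hub_arcs :: "(nat \<times> nat) set" where
  "hub_arcs = (\<Union>(i, j, k) \<in> turns.
     {(4 * i + j, 4 * j + k), (4 * j + k, 4 * i + j), (4 * i + j, 4 * j + i)})"

text \<open>Division of a hub code by 4 recovers its block, so \<open>c\<close> names the block to
  which a leaf is attached. Taking the arcs to be ordered pairs of vertices rules out parallel arcs
  and identifies the arc set with the adjacency relation.\<close>

definition leaf_graph :: "nat set \<Rightarrow> (nat \<Rightarrow> nat) \<Rightarrow> (nat, nat \<times> nat) pre_digraph" where
  "leaf_graph V c = \<lparr>verts = hub \<union> V,
     arcs = hub_arcs \<union> {(u, v). u \<in> hub \<and> v \<in> V \<and> u div 4 = c v}
                    \<union> {(v, u). u \<in> hub \<and> v \<in> V \<and> u div 4 = c v},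
     tail = fst, head = snd\<rparr>"

section \<open>The hub in explicit form, and leaf graphs as simple graphs\<close>

lemma hub_eq: "hub = {1, 2, 3, 4, 6, 7, 8, 9, 11, 12, 13, 14}"
  unfolding hub_def turns_def by auto

lemma hub_arcs_eq: "hub_arcs =
   {(9,7), (7,9), (9,6), (14,9), (9,14), (14,11), (7,14), (14,7), (7,13),
    (4,3), (3,4), (4,1), (13,4), (4,13), (13,7), (3,13), (13,3), (3,12),
    (12,2), (2,12), (12,3), (11,12), (12,11), (11,14), (2,11), (11,2), (2,8),
    (8,1), (1,8), (8,2), (6,8), (8,6), (6,9), (1,6), (6,1), (1,4)}"
  unfolding hub_arcs_def turns_def by (simp add: One_nat_def[symmetric])

lemma hub_arcs_subset: "hub_arcs \<subseteq> hub \<times> hub"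
  unfolding hub_arcs_eq hub_eq by auto

lemma leaf_graph_simps [simp]:
  "verts (leaf_graph V c) = hub \<union> V"
  "tail (leaf_graph V c) = fst" "head (leaf_graph V c) = snd"
  by (simp_all add: leaf_graph_def)

lemma arcs_leaf_graph: "arcs (leaf_graph V c) =
    hub_arcs \<union> {(u, v). u \<in> hub \<and> v \<in> V \<and> u div 4 = c v}
             \<union> {(v, u). u \<in> hub \<and> v \<in> V \<and> u div 4 = c v}"
  by (simp add: leaf_graph_def)

lemma arcs_ends_leaf_graph: "arcs_ends (leaf_graph V c) = arcs (leaf_graph V c)"
  by (auto simp: arcs_ends_conv)

lemma wf_leaf_graph: "wf_digraph (leaf_graph V c)"
  using hub_arcs_subset by unfold_locales (auto simp: arcs_leaf_graph)

lemma graph_leaf_graph: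
  assumes "finite V" "V \<inter> hub = {}"
  shows "graph (leaf_graph V c)"
proof -
  interpret wf_digraph "leaf_graph V c" by (rule wf_leaf_graph)
  have fin: "finite hub" by (simp add: hub_eq)
  have "arcs (leaf_graph V c) \<subseteq> (hub \<union> V) \<times> (hub \<union> V)"
    using hub_arcs_subset by (auto simp: arcs_leaf_graph)
  then have fa: "finite (arcs (leaf_graph V c))"
    using fin assms(1) by (meson finite_SigmaI finite_UnI finite_subset)
  have lf: "fst e \<noteq> snd e" if "e \<in> hub_arcs" for e
    using that unfolding hub_arcs_eq by auto
  have sy: "(v, u) \<in> hub_arcs" if "(u, v) \<in> hub_arcs" for u v
    using that unfolding hub_arcs_eq by (elim insertE emptyE) simp_all
  show ?thesis
  proof unfold_locales
    show "finite (verts (leaf_graph V c))" using fin assms by simp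
    show "finite (arcs (leaf_graph V c))" by (rule fa)
    show "tail (leaf_graph V c) e \<noteq> head (leaf_graph V c) e" if "e \<in> arcs (leaf_graph V c)" for e
      using that lf assms(2) by (auto simp: arcs_leaf_graph)
    show "e1 = e2" if "arc_to_ends (leaf_graph V c) e1 = arc_to_ends (leaf_graph V c) e2" for e1 e2
      using that by (simp add: arc_to_ends_def prod_eq_iff)
    show "symmetric (leaf_graph V c)"
      using sy by (auto simp: symmetric_def arcs_ends_leaf_graph sym_def arcs_leaf_graph)
  qed
qed

text \<open>Cards at leaves stay inside the family, so one isomorphism criterion for leaf graphs
  covers them.\<close>

lemma del_vert_leaf_graph:
  assumes "v \<in> V" "V \<inter> hub = {}"
  shows "pre_digraph.del_vert (leaf_graph V c) v = leaf_graph (V - {v}) c"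
proof -
  have "v \<notin> hub" using assms by blast
  then show ?thesis
    using hub_arcs_subset unfolding leaf_graph_def pre_digraph.del_vert_def by auto
qed

section \<open>Symmetries of the hub and isomorphisms of leaf graphs\<close>

text \<open>The map \<open>q\<close> is the action of \<open>p\<close> on encoded ordered pairs. Hub
  and hub arcs are built from \<open>turns\<close> by formulas that commute with relabelling the
  indices, so the invariance of \<open>turns\<close> passes to both.\<close>

lemma hub_lift:
  fixes p :: "nat \<Rightarrow> nat"
  assumes p: "(\<lambda>(i, j, k). (p i, p j, p k)) ` turns = turns"
  defines "q \<equiv> \<lambda>u. 4 * p (u div 4) + p (u mod 4)"
  shows "q ` hub = hub" "map_prod q q ` hub_arcs = hub_arcs" "inj_on q hub"
    "u \<in> hub \<Longrightarrow> q u div 4 = p (u div 4)"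
    "inj_on p {..<4}" "p ` {..<4} = {..<4}"
proof -
  have lt: "i < 4" "j < 4" "k < 4" if "(i, j, k) \<in> turns" for i j k
    using that unfolding turns_def by auto
  have pt: "(p i, p j, p k) \<in> turns" if "(i, j, k) \<in> turns" for i j k
    using p that by force
  have q: "q (4 * i + j) = 4 * p i + p j" if "j < 4" for i j
    using that by (simp add: q_def)
  have "q ` hub = (\<lambda>(i, j, k). 4 * i + j) ` (\<lambda>(i, j, k). (p i, p j, p k)) ` turns"
    unfolding hub_def image_image by (intro image_cong) (auto simp: q lt)
  then show qh: "q ` hub = hub"
    unfolding p by (simp add: hub_def)
  have "map_prod q q ` hub_arcs = (\<Union>(i, j, k) \<in> (\<lambda>(i, j, k). (p i, p j, p k)) ` turns.
     {(4 * i + j, 4 * j + k), (4 * j + k, 4 * i + j), (4 * i + j, 4 * j + i)})"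
    unfolding hub_arcs_def image_UN image_image
    by (intro SUP_cong) (auto simp: q lt)
  then show "map_prod q q ` hub_arcs = hub_arcs"
    unfolding p by (simp add: hub_arcs_def)
  show "inj_on q hub"
    by (rule eq_card_imp_inj_on) (simp_all add: qh, simp add: hub_eq)
  \<comment> \<open>Every index is the first entry of some turn, so invariance of
    \<open>turns\<close> makes \<open>p\<close> permute the four indices.\<close>
  have fstt: "{..<4} = fst ` turns"
    unfolding turns_def by (auto simp: lessThan_nat_numeral lessThan_Suc)
  have "p ` {..<4} = fst ` (\<lambda>(i, j, k). (p i, p j, p k)) ` turns"
    unfolding fstt image_image by (intro image_cong) auto
  then show pim: "p ` {..<4} = {..<4}" unfolding p using fstt by simp
  then show "inj_on p {..<4}" by (intro eq_card_imp_inj_on) auto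
  assume "u \<in> hub"
  then have "u div 4 < 4" "u mod 4 < 4" unfolding hub_eq by auto
  then have "p (u mod 4) < 4" using pim by blast
  then show "q u div 4 = p (u div 4)" by (simp add: q_def)
qed

text \<open>The isomorphism is the lifted symmetry on the hub and a fibrewise matching on the
  leaves. The matching exists as soon as block \<open>p a\<close> of the target carries as many
  leaves as block \<open>a\<close> of the source.\<close>

lemma digraph_iso_leaf_graph:
  assumes p: "(\<lambda>(i, j, k). (p i, p j, p k)) ` turns = turns"
    and fin: "finite V" "finite W" and dj: "V \<inter> hub = {}" "W \<inter> hub = {}"
    and c: "\<And>v. v \<in> V \<Longrightarrow> c v < 4"
    and fib: "\<And>b. card {v \<in> V. p (c v) = b} = card {w \<in> W. d w = b}"
  shows "digraph_iso (leaf_graph V c) (leaf_graph W d)"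
proof -
  obtain h where h: "bij_betw h V W" and dh: "\<And>v. v \<in> V \<Longrightarrow> d (h v) = p (c v)"
    using bij_betw_fibres[OF fin, of "\<lambda>v. p (c v)" d] fib by blast
  define q where "q u = 4 * p (u div 4) + p (u mod 4)" for u
  note q = hub_lift[OF p, folded q_def]
  define f where "f u = (if u \<in> hub then q u else h u)" for u
  have fq: "f u = q u" if "u \<in> hub" for u using that by (simp add: f_def)
  have fh: "f v = h v" if "v \<in> V" for v using that dj by (auto simp: f_def)
  have fV: "f ` V = W" using h fh by (simp add: bij_betw_def)
  have fhub: "f ` hub = hub" using q(1) fq by simp
  have inj: "inj_on f (hub \<union> V)"
  proof -
    have "inj_on f hub" using q(3) fq inj_on_cong by metis
    moreover have "inj_on f V" using h fh inj_on_cong unfolding bij_betw_def by metis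
    ultimately show ?thesis using fV fhub dj by (auto simp: inj_on_Un)
  qed
  \<comment> \<open>Injectivity of \<open>p\<close> on the block indices gives the direction from
    left to right, by which every leaf arc of the target is hit.\<close>
  have lab: "f u div 4 = d (f v) \<longleftrightarrow> u div 4 = c v" if "u \<in> hub" "v \<in> V" for u v
  proof -
    have "u div 4 < 4" using that unfolding hub_eq by auto
    then show ?thesis
      using that q(4)[of u] dh[of v] c[of v] inj_on_eq_iff[OF q(5), of "u div 4" "c v"]
      by (simp add: fq fh)
  qed
  have img: "map_prod f f ` {(u, v). u \<in> hub \<and> v \<in> V \<and> u div 4 = c v}
      = {(u, v). u \<in> hub \<and> v \<in> W \<and> u div 4 = d v}"
  proof -
    have "{(u, v). u \<in> hub \<and> v \<in> W \<and> u div 4 = d v}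
        = {(u, v). u \<in> f ` hub \<and> v \<in> f ` V \<and> u div 4 = d v}"
      by (simp only: fhub fV)
    then show ?thesis using lab by auto
  qed
  have img': "map_prod f f ` {(v, u). u \<in> hub \<and> v \<in> V \<and> u div 4 = c v}
      = {(v, u). u \<in> hub \<and> v \<in> W \<and> u div 4 = d v}"
  proof -
    have "{(v, u). u \<in> hub \<and> v \<in> W \<and> u div 4 = d v}
        = {(v, u). u \<in> f ` hub \<and> v \<in> f ` V \<and> u div 4 = d v}"
      by (simp only: fhub fV)
    then show ?thesis using lab by auto
  qed
  have "map_prod f f ` hub_arcs = map_prod q q ` hub_arcs"
    using hub_arcs_subset fq by (intro image_cong) auto
  then have arcs: "map_prod f f ` arcs (leaf_graph V c) = arcs (leaf_graph W d)"
    unfolding arcs_leaf_graph image_Un img img' q(2) by simp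
  let ?F = "\<lparr>iso_verts = f, iso_arcs = map_prod f f, iso_head = snd, iso_tail = fst\<rparr>"
  have "inj_on (map_prod f f) ((hub \<union> V) \<times> (hub \<union> V))"
    using inj by (intro map_prod_inj_on)
  moreover have "arcs (leaf_graph V c) \<subseteq> (hub \<union> V) \<times> (hub \<union> V)"
    using hub_arcs_subset by (auto simp: arcs_leaf_graph)
  ultimately have "inj_on (map_prod f f) (arcs (leaf_graph V c))"
    by (rule inj_on_subset)
  then have "pre_digraph.digraph_isomorphism (leaf_graph V c) ?F"
    using inj wf_leaf_graph by (simp add: pre_digraph.digraph_isomorphism_def)
  moreover have "leaf_graph W d = app_iso ?F (leaf_graph V c)"
    by (intro pre_digraph.equality) (simp_all add: arcs image_Un fhub fV)
  ultimately show ?thesis unfolding digraph_iso_def by blast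
qed

section \<open>Connectedness and degrees of leaf graphs\<close>

lemma connected_leaf_graph:
  assumes "finite V" "V \<inter> hub = {}" "\<And>v. v \<in> V \<Longrightarrow> c v < 4"
  shows "Digraph_Component.connected (leaf_graph V c)"
proof -
  let ?G = "leaf_graph V c"
  interpret graph ?G using assms by (intro graph_leaf_graph)
  have hub_arc: "u \<rightarrow>\<^sup>*\<^bsub>?G\<^esub> v" if "(u, v) \<in> hub_arcs" for u v
    using that by (intro reachable_adjI) (simp add: arcs_ends_leaf_graph arcs_leaf_graph)
  \<comment> \<open>These eleven arcs form a spanning tree of the hub rooted at \<open>1\<close>.
    Each leaf is then reached through a vertex of its block.\<close>
  have a: "1 \<rightarrow>\<^sup>*\<^bsub>?G\<^esub> 6" "1 \<rightarrow>\<^sup>*\<^bsub>?G\<^esub> 4" "1 \<rightarrow>\<^sup>*\<^bsub>?G\<^esub> 8" "6 \<rightarrow>\<^sup>*\<^bsub>?G\<^esub> 9" "8 \<rightarrow>\<^sup>*\<^bsub>?G\<^esub> 2"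
    "2 \<rightarrow>\<^sup>*\<^bsub>?G\<^esub> 11" "2 \<rightarrow>\<^sup>*\<^bsub>?G\<^esub> 12" "4 \<rightarrow>\<^sup>*\<^bsub>?G\<^esub> 13" "4 \<rightarrow>\<^sup>*\<^bsub>?G\<^esub> 3" "9 \<rightarrow>\<^sup>*\<^bsub>?G\<^esub> 14" "9 \<rightarrow>\<^sup>*\<^bsub>?G\<^esub> 7"
    by (rule hub_arc, simp add: hub_arcs_eq)+
  have "1 \<rightarrow>\<^sup>*\<^bsub>?G\<^esub> 1" by (simp add: hub_eq)
  with a have hub1: "1 \<rightarrow>\<^sup>*\<^bsub>?G\<^esub> u" if "u \<in> hub" for u
    using that unfolding hub_eq by (auto intro: reachable_trans)
  have "1 \<rightarrow>\<^sup>*\<^bsub>?G\<^esub> v" if "v \<in> V" for v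
  proof -
    have "c v \<in> {0, 1, 2, 3}" using assms(3)[OF that] by auto
    then obtain u where u: "u \<in> hub" "u div 4 = c v"
      unfolding hub_eq by fastforce
    then have "u \<rightarrow>\<^bsub>?G\<^esub> v" using that by (simp add: arcs_ends_leaf_graph arcs_leaf_graph)
    then show ?thesis using hub1[OF u(1)] reachable_adj_trans by blast
  qed
  with hub1 have "1 \<rightarrow>\<^sup>*\<^bsub>?G\<^esub> v" if "v \<in> verts ?G" for v
    using that by auto
  then have "u \<rightarrow>\<^sup>*\<^bsub>?G\<^esub> v" if "u \<in> verts ?G" "v \<in> verts ?G" for u v
    using that symmetric_reachable' reachable_trans by meson
  moreover have "verts ?G \<noteq> {}" by (simp add: hub_eq)
  ultimately show ?thesis
    unfolding Digraph_Component.connected_def strongly_connected_def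
    by (simp add: reachable_mk_symmetricI)
qed

text \<open>The hub is cubic: the pair \<open>(i, j)\<close> has one successor
  \<open>(j, k)\<close>, one predecessor \<open>(k, i)\<close> and its reversal
  \<open>(j, i)\<close> as neighbours.\<close>

lemma out_degree_hub:
  assumes "finite V" "V \<inter> hub = {}" "u \<in> hub"
  shows "out_degree (leaf_graph V c) u = 3 + card {v \<in> V. c v = u div 4}"
proof -
  have "out_arcs (leaf_graph V c) u = Pair u ` ({v. (u, v) \<in> hub_arcs} \<union> {v \<in> V. c v = u div 4})"
    using assms(2,3) by (auto simp: out_arcs_def arcs_leaf_graph)
  then have "out_degree (leaf_graph V c) u = card ({v. (u, v) \<in> hub_arcs} \<union> {v \<in> V. c v = u div 4})"
    by (simp add: out_degree_def card_image inj_on_def)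
  also have "\<dots> = card {v. (u, v) \<in> hub_arcs} + card {v \<in> V. c v = u div 4}"
  proof (rule card_Un_disjoint)
    have sub: "{v. (u, v) \<in> hub_arcs} \<subseteq> hub" using hub_arcs_subset by auto
    then show "finite {v. (u, v) \<in> hub_arcs}" by (rule finite_subset) (simp add: hub_eq)
    show "{v. (u, v) \<in> hub_arcs} \<inter> {v \<in> V. c v = u div 4} = {}"
      using sub assms(2) by blast
  qed (simp add: assms(1))
  also have "card {v. (u, v) \<in> hub_arcs} = 3"
    using assms(3) unfolding hub_eq hub_arcs_eq
    by (elim insertE emptyE) (simp_all add: Collect_disj_eq)
  finally show ?thesis .
qed

lemma out_degree_leaf:
  assumes "V \<inter> hub = {}" "v \<in> V" "c v < 4"
  shows "out_degree (leaf_graph V c) v = 3"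
proof -
  have v: "v \<notin> hub" using assms by blast
  then have "out_arcs (leaf_graph V c) v = Pair v ` {u \<in> hub. u div 4 = c v}"
    using assms(1,2) hub_arcs_subset by (auto simp: out_arcs_def arcs_leaf_graph)
  then have "out_degree (leaf_graph V c) v = card {u \<in> hub. u div 4 = c v}"
    by (simp add: out_degree_def card_image inj_on_def)
  also have "\<dots> = 3"
  proof -
    have "{u \<in> hub. u div 4 = 0} = {1, 2, 3}" "{u \<in> hub. u div 4 = 1} = {4, 6, 7}"
      "{u \<in> hub. u div 4 = 2} = {8, 9, 11}" "{u \<in> hub. u div 4 = 3} = {12, 13, 14}"
      unfolding hub_eq by auto
    moreover have "c v = 0 \<or> c v = 1 \<or> c v = 2 \<or> c v = 3" using assms(3) by linarith
    ultimately show ?thesis by (elim disjE) simp_all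
  qed
  finally show ?thesis .
qed

section \<open>The two assignments of leaves to blocks\<close>

text \<open>On \<open>leaves\<close> the cut points leave runs of lengths 15, 16, 17 and 18.\<close>

definition level :: "nat \<Rightarrow> nat" where
  "level v = (if v < 31 then 0 else if v < 47 then 1 else if v < 64 then 2 else 3)"

text \<open>This is \<open>level\<close> followed by the transposition of blocks 0 and 1, an odd
  permutation.\<close>

definition level' :: "nat \<Rightarrow> nat" where
  "level' v = (if v < 31 then 1 else if v < 47 then 0 else if v < 64 then 2 else 3)"

text \<open>The range starts beyond the largest hub code, 14. Its 66 elements and the 12 hub
  vertices make 78.\<close>

definition leaves :: "nat set" where
  "leaves = {16..<82}"


lemma level_lt: "level v < 4" and level'_lt: "level' v < 4"
  by (simp_all add: level_def level'_def)

lemma leaves_disjoint: "leaves \<inter> hub = {}"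
  by (auto simp: hub_eq leaves_def)

lemma finite_leaves: "finite leaves"
  by (simp add: leaves_def)

lemma card_level:
  "card {v \<in> leaves. level v = 0} = 15" "card {v \<in> leaves. level v = 1} = 16"
  "card {v \<in> leaves. level v = 2} = 17" "card {v \<in> leaves. level v = 3} = 18"
proof -
  have "{v \<in> leaves. level v = 0} = {16..<31}" "{v \<in> leaves. level v = 1} = {31..<47}"
    "{v \<in> leaves. level v = 2} = {47..<64}" "{v \<in> leaves. level v = 3} = {64..<82}"
    by (auto simp: level_def leaves_def)
  then show "card {v \<in> leaves. level v = 0} = 15" "card {v \<in> leaves. level v = 1} = 16"
    "card {v \<in> leaves. level v = 2} = 17" "card {v \<in> leaves. level v = 3} = 18"
    by simp_all
qed

lemma level'_eq:
  "level' v = 0 \<longleftrightarrow> level v = 1" "level' v = 1 \<longleftrightarrow> level v = 0"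
  "level' v = 2 \<longleftrightarrow> level v = 2" "level' v = 3 \<longleftrightarrow> level v = 3"
  by (auto simp: level_def level'_def)

lemma card_level_delete:
  assumes "v \<in> leaves"
  shows "card {u \<in> leaves - {v}. level u = b}
    = card {u \<in> leaves. level u = b} - (if level v = b then 1 else 0)"
proof -
  have "{u \<in> leaves - {v}. level u = b} = {u \<in> leaves. level u = b} - {v}" by auto
  then show ?thesis using assms by (auto simp: card_Diff_singleton_if)
qed

section \<open>The common cards\<close>

text \<open>The range omits exactly the 15 leaves of the smallest set. The same leaf is deleted on
  both sides, and an even permutation \<open>p\<close> of the blocks is found that matches the
  remaining sizes.\<close>

lemma vertex_card_eq:
  assumes v: "v \<in> {31..<82}"
  shows "vertex_card (leaf_graph leaves level) v = vertex_card (leaf_graph leaves level') v"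
proof -
  have vl: "v \<in> leaves" using v by (simp add: leaves_def)
  let ?V = "leaves - {v}"
  define N where "N b = card {u \<in> ?V. level u = b}" for b
  define N' where "N' b = card {u \<in> ?V. level' u = b}" for b
  have N: "N 0 = 15 - (if level v = 0 then 1 else 0)" "N 1 = 16 - (if level v = 1 then 1 else 0)"
    "N 2 = 17 - (if level v = 2 then 1 else 0)" "N 3 = 18 - (if level v = 3 then 1 else 0)"
    unfolding N_def card_level_delete[OF vl] card_level by (rule refl)+
  have N': "N' 0 = N 1" "N' 1 = N 0" "N' 2 = N 2" "N' 3 = N 3"
    unfolding N_def N'_def level'_eq by (rule refl)+
  have less4: "b < 4 \<longleftrightarrow> b = 0 \<or> b = 1 \<or> b = 2 \<or> b = 3" for b :: nat by linarith
  have iso: "digraph_iso (leaf_graph ?V level) (leaf_graph ?V level')"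
    if p: "(\<lambda>(i, j, k). (p i, p j, p k)) ` turns = turns"
      and eq: "N 0 = N' (p 0)" "N 1 = N' (p 1)" "N 2 = N' (p 2)" "N 3 = N' (p 3)" for p
  proof (rule digraph_iso_leaf_graph[OF p])
    fix b
    note perm = hub_lift(5,6)[OF p]
    show "card {u \<in> ?V. p (level u) = b} = card {w \<in> ?V. level' w = b}"
    proof (cases "b < 4")
      case True
      then obtain a where a: "a < 4" "b = p a" using perm(2) by (metis image_iff lessThan_iff)
      then have "{u \<in> ?V. p (level u) = b} = {u \<in> ?V. level u = a}"
        using inj_onD[OF perm(1)] level_lt by auto
      moreover have "N a = N' (p a)" using a(1) eq unfolding less4 by auto
      ultimately show ?thesis using a(2) by (simp add: N_def N'_def)
    next
      \<comment> \<open>The criterion ranges over all naturals \<open>b\<close>; for labels outside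
        the four blocks both fibres are empty.\<close>
      case False
      then have "p (level u) \<noteq> b" "level' u \<noteq> b" for u
        using perm(2) level_lt level'_lt by blast+
      then show ?thesis by simp
    qed
  qed (use leaves_disjoint finite_leaves level_lt in auto)
  consider "level v = 1" | "level v = 2" | "level v = 3"
    using v by (cases "v < 47"; cases "v < 64") (auto simp: level_def)
  then have "digraph_iso (leaf_graph ?V level) (leaf_graph ?V level')"
  proof cases
    case 1
    \<comment> \<open>The sizes are 15, 15, 17, 18 for both labellings, so nothing has to
      move.\<close>
    show ?thesis by (rule iso[of id]) (simp_all add: N N' 1 turns_def)
  next
    case 2
    \<comment> \<open>The sizes 15, 16, 16, 18 become 16, 15, 16, 18. The two sets of size 16 allow
      a 3-cycle in place of the transposition.\<close>
    show ?thesis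
      by (rule iso[of "id(0 := 1, 1 := 2, 2 := 0)"]) (simp_all add: N N' 2, auto simp: turns_def)
  next
    case 3
    \<comment> \<open>The sizes 15, 16, 17, 17 become 16, 15, 17, 17. Exchanging also the two sets
      of size 17 makes the permutation even.\<close>
    show ?thesis
      by (rule iso[of "id(0 := 1, 1 := 0, 2 := 3, 3 := 2)"]) (simp_all add: N N' 3, auto simp: turns_def)
  qed
  then show ?thesis
    unfolding vertex_card_def del_vert_leaf_graph[OF vl leaves_disjoint]
    by (simp add: iso_class_eq_iff wf_leaf_graph)
qed

lemma common_cards_ge:
  "common_cards (leaf_graph leaves level) (leaf_graph leaves level') \<ge> 51"
proof -
  let ?G = "leaf_graph leaves level" and ?H = "leaf_graph leaves level'"
  \<comment> \<open>These 51 leaves yield a multiset of cards contained in both decks.\<close>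
  let ?M = "mset_set {31..<82 :: nat}"
  have sub: "?M \<subseteq># mset_set (hub \<union> leaves)"
    by (rule subset_imp_msubset_mset_set) (auto simp: hub_eq leaves_def)
  have "image_mset (vertex_card ?G) ?M \<subseteq># vertex_deck ?G"
    using image_mset_subseteq_mono[OF sub] by (simp add: vertex_deck_def)
  moreover have "image_mset (vertex_card ?G) ?M = image_mset (vertex_card ?H) ?M"
    by (rule image_mset_cong) (simp add: vertex_card_eq)
  then have "image_mset (vertex_card ?G) ?M \<subseteq># vertex_deck ?H"
    using image_mset_subseteq_mono[OF sub, of "vertex_card ?H"] by (simp add: vertex_deck_def)
  ultimately have "image_mset (vertex_card ?G) ?M \<subseteq># vertex_deck ?G \<inter># vertex_deck ?H"
    by simp
  from size_mset_mono[OF this] show ?thesis by (simp add: common_cards_def)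
qed

section \<open>Degree sequences and nonisomorphism\<close>

text \<open>Hub degrees identify the block of a vertex and are all far above the degree 3 of a
  leaf.\<close>

lemma out_degree_level:
  assumes "u \<in> hub"
  shows "out_degree (leaf_graph leaves level) u = (if u \<in> {1, 2, 3} then 18
     else if u \<in> {4, 6, 7} then 19 else if u \<in> {8, 9, 11} then 20 else 21)"
    and "out_degree (leaf_graph leaves level') u = (if u \<in> {1, 2, 3} then 19
     else if u \<in> {4, 6, 7} then 18 else if u \<in> {8, 9, 11} then 20 else 21)"
  using assms unfolding hub_eq
  by (elim insertE emptyE;
      simp add: out_degree_hub[OF finite_leaves leaves_disjoint] hub_eq level'_eq card_level)+

text \<open>Exchanging the sizes 15 and 16 only swaps the degrees of two blocks that have three
  vertices each.\<close>

lemma degree_sequence_eq: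
  "degree_sequence (leaf_graph leaves level) = degree_sequence (leaf_graph leaves level')"
proof -
  have fin: "finite hub" by (simp add: hub_eq)
  have "image_mset (out_degree (leaf_graph leaves level)) (mset_set leaves)
      = image_mset (out_degree (leaf_graph leaves level')) (mset_set leaves)"
    by (intro image_mset_cong)
       (simp add: out_degree_leaf[OF leaves_disjoint] level_lt level'_lt finite_leaves)
  moreover have "image_mset (out_degree (leaf_graph leaves level)) (mset_set hub)
      = image_mset (out_degree (leaf_graph leaves level')) (mset_set hub)"
    by (simp add: hub_eq out_degree_level)
  ultimately show ?thesis
    using fin finite_leaves leaves_disjoint
    by (simp add: degree_sequence_def mset_set_Union Int_commute)
qed

text \<open>Degrees force an isomorphism to preserve the hub, to exchange blocks 0 and 1 and to fix
  block 2. Vertex \<open>1\<close> has neighbours \<open>4\<close> and \<open>6\<close> in block 1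
  and \<open>8\<close> in block 2, so its image in block 1 would need two neighbours in block 0 and
  one in block 2.\<close>

lemma not_digraph_iso:
  "\<not> digraph_iso (leaf_graph leaves level) (leaf_graph leaves level')"
proof
  let ?G = "leaf_graph leaves level" and ?H = "leaf_graph leaves level'"
  assume "digraph_iso ?G ?H"
  then obtain f where f: "pre_digraph.digraph_isomorphism ?G f" and H: "?H = app_iso f ?G"
    unfolding digraph_iso_def by blast
  interpret G: wf_digraph ?G by (rule wf_leaf_graph)
  let ?f = "iso_verts f"
  have deg: "out_degree ?H (?f u) = out_degree ?G u" if "u \<in> hub" for u
    using G.out_degree_app_iso_eq[OF f, of u] that H by simp
  have hub_f: "?f u \<in> hub" if "u \<in> hub" for u
  proof (rule ccontr)
    assume "?f u \<notin> hub"
    moreover have "?f u \<in> verts ?H" using that by (subst H) simp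
    ultimately have "out_degree ?H (?f u) = 3"
      using out_degree_leaf[OF leaves_disjoint] level'_lt by simp
    then show False using deg[OF that] out_degree_level(1)[OF that] by (simp split: if_splits)
  qed
  have adj: "(?f u, ?f v) \<in> hub_arcs" if "(u, v) \<in> hub_arcs" for u v
  proof -
    have uv: "u \<in> hub" "v \<in> hub" using that hub_arcs_subset by auto
    have "(u, v) \<in> arcs_ends ?G"
      using that by (simp add: arcs_ends_leaf_graph arcs_leaf_graph)
    then have "(?f u, ?f v) \<in> arcs_ends (app_iso f ?G)"
      unfolding G.arcs_ends_app_iso_eq[OF f] by force
    then have "(?f u, ?f v) \<in> arcs ?H" by (simp add: H[symmetric] arcs_ends_leaf_graph)
    then show ?thesis
      using hub_f[OF uv(1)] hub_f[OF uv(2)] leaves_disjoint by (auto simp: arcs_leaf_graph)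
  qed
  have h: "1 \<in> hub" "4 \<in> hub" "6 \<in> hub" "8 \<in> hub" by (simp_all add: hub_eq)
  have ne: "?f 4 \<noteq> ?f 6"
    using G.iso_verts_eq_iff[OF f, of 4 6] h by simp
  have f1: "?f 1 = 4 \<or> ?f 1 = 6 \<or> ?f 1 = 7"
    and f468: "?f 4 \<in> {1, 2, 3}" "?f 6 \<in> {1, 2, 3}" "?f 8 \<in> {8, 9, 11}"
    using h[THEN deg] h[THEN hub_f, THEN out_degree_level(2)] out_degree_level(1) h
    by (auto split: if_splits)
  have arcs: "(?f 1, ?f 4) \<in> hub_arcs" "(?f 1, ?f 6) \<in> hub_arcs" "(?f 1, ?f 8) \<in> hub_arcs"
    by (rule adj, simp add: hub_arcs_eq)+
  \<comment> \<open>No candidate fits: \<open>4\<close> has no neighbour in block 2,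
    \<open>6\<close> has only one in block 0, and \<open>7\<close> has none in block 0.\<close>
  from f1 show False
  proof (elim disjE)
    assume "?f 1 = 4"
    then show False using arcs(3) f468(3) by (auto simp: hub_arcs_eq)
  next
    assume "?f 1 = 6"
    then show False using arcs(1,2) f468(1,2) ne by (auto simp: hub_arcs_eq)
  next
    assume "?f 1 = 7"
    then show False using arcs(1) f468(1) by (auto simp: hub_arcs_eq)
  qed
qed

theorem theorem2p2:
  shows "\<exists>G H :: (nat, nat \<times> nat) pre_digraph.
    graph G \<and> graph H \<and>
    card (verts G) = 78 \<and> card (verts H) = 78 \<and>
    Digraph_Component.connected G \<and> Digraph_Component.connected H \<and>
    \<not> digraph_iso G H \<and>
    degree_sequence G = degree_sequence H \<and>
    common_cards G H \<ge> 51 \<and> (51 :: int) > 50 \<and> 50 = Q 78"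
proof (intro exI conjI)
  let ?G = "leaf_graph leaves level" and ?H = "leaf_graph leaves level'"
  show "graph ?G" "graph ?H"
    using graph_leaf_graph finite_leaves leaves_disjoint by simp_all
  have "card (hub \<union> leaves) = 78"
    using leaves_disjoint by (subst card_Un_disjoint) (auto simp: hub_eq leaves_def)
  then show "card (verts ?G) = 78" "card (verts ?H) = 78" by simp_all
  show "Digraph_Component.connected ?G" "Digraph_Component.connected ?H"
    using finite_leaves leaves_disjoint level_lt level'_lt by (simp_all add: connected_leaf_graph)
  show "\<not> digraph_iso ?G ?H" by (rule not_digraph_iso)
  show "degree_sequence ?G = degree_sequence ?H" by (rule degree_sequence_eq)
  show "common_cards ?G ?H \<ge> 51" by (rule common_cards_ge)
  show "(51 :: int) > 50" by simp
  have "\<lfloor>(77 / 3 :: real)\<rfloor> = 25" by linarith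
  then show "50 = Q 78" by (simp add: Q_def)
qed

end
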